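(* Let $D_i=-\lambda_i+\sum_{j\ne i}\lambda_jp_{ji}$ for $i\in\mathcal N$, and suppose that a feasible assignment $(\alpha,\beta)$ exists. Consider the two linear programs $$(\mathrm P_\alpha)\quad\text{minimize }\sum_{i,j}T_{ij}\alpha_{ij}\ \text{ subject to }\ \sum_{j\ne i}(\alpha_{ij}-\alpha_{ji})=D_i\ \ \forall i\in\mathcal N,\quad\alpha_{ij}\ge0\ \ \forall i,j\in\mathcal N,$$ $$(\mathrm P_\beta)\quad\text{minimize }\sum_{i,j}T_{ij}\beta_{ij}\ \text{ subject to }\ \sum_{j\ne i}(\beta_{ij}-\beta_{ji})=-D_i\ \ \forall i\in\mathcal N,\quad0\le\beta_{ij}\le f_{ij}\lambda_ip_{ij}\ \ \forall i,j\in\mathcal N.$$ Then both programs have optimal solutions, and for any optimal solutions $\alpha^*$ of $(\mathrm P_\alpha)$ and $\beta^*$ of $(\mathrm P_\beta)$, the pair $(\alpha^*,\beta^* )$ is a feasible assignment that simultaneously minimizes, over all feasible assignments $(\alpha,\beta)$, both the number of rebalancing vehicles $\sum_{i,j}T_{ij}\alpha_{ij}$ and the number of drivers $\sum_{i,j}T_{ij}(\alpha_{ij}+\beta_{ij})$.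
   Context: Parameters: $\mathcal N=\{1,\dots,n\}$; $\lambda_i>0$ (customer arrival rate at station $i$); $p_{ij}\ge0$ with $p_{ii}=0$ and $\sum_jp_{ij}=1$ (fraction of customers at $i$ destined for $j$); $T_{ij}\ge0$ (travel times); $f_{ij}\in(0,1]$ (fraction of customers travelling from $i$ to $j$ willing to use a taxi). Standing assumption: $D_i\ne0$ for all $i\in\mathcal N$. All matrices $\alpha,\beta$ are real $n\times n$ with zero diagonals; $\alpha_{ij}$ is the rate of rebalancing vehicles (each with a driver) and $\beta_{ij}$ the rate of drivers on customer-carrying vehicles sent from $i$ to $j$. A feasible assignment is a pair $(\alpha,\beta)$ with $$\sum_{j\ne i}(\alpha_{ij}-\alpha_{ji})=D_i,\qquad\sum_{j\ne i}(\beta_{ij}-\beta_{ji})=-D_i\qquad\forall i\in\mathcal N,$$ and $\alpha_{ij}\ge0$, $0\le\beta_{ij}\le f_{ij}\lambda_ip_{ij}$ for all $i,j\in\mathcal N$. *)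

theory Defs
  imports "HOL-Analysis.Analysis"
begin

(* The stations are the elements of a finite type 'n. *)

definition imbalance :: "real ^ 'n \<Rightarrow> real ^ 'n ^ 'n \<Rightarrow> 'n::finite \<Rightarrow> real" where
  "imbalance lam p i = - lam $ i + (\<Sum>j | j \<noteq> i. lam $ j * p $ j $ i)"

definition net_outflow :: "real ^ 'n ^ 'n \<Rightarrow> 'n::finite \<Rightarrow> real" where
  "net_outflow A i = (\<Sum>j | j \<noteq> i. A $ i $ j - A $ j $ i)"

definition zero_diagonal :: "real ^ 'n ^ 'n \<Rightarrow> bool" where
  "zero_diagonal A \<longleftrightarrow> (\<forall>i. A $ i $ i = 0)"

definition feasible_alpha ::
    "real ^ 'n \<Rightarrow> real ^ 'n ^ 'n \<Rightarrow> real ^ 'n ^ 'n::finite \<Rightarrow> bool" where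
  "feasible_alpha lam p \<alpha> \<longleftrightarrow>
     zero_diagonal \<alpha> \<and>
     (\<forall>i. net_outflow \<alpha> i = imbalance lam p i) \<and>
     (\<forall>i j. 0 \<le> \<alpha> $ i $ j)"

definition feasible_beta ::
    "real ^ 'n \<Rightarrow> real ^ 'n ^ 'n \<Rightarrow> real ^ 'n ^ 'n \<Rightarrow> real ^ 'n ^ 'n::finite \<Rightarrow> bool" where
  "feasible_beta lam p f \<beta> \<longleftrightarrow>
     zero_diagonal \<beta> \<and>
     (\<forall>i. net_outflow \<beta> i = - imbalance lam p i) \<and>
     (\<forall>i j. 0 \<le> \<beta> $ i $ j \<and> \<beta> $ i $ j \<le> f $ i $ j * lam $ i * p $ i $ j)"

definition feasible_assignment ::
    "real ^ 'n \<Rightarrow> real ^ 'n ^ 'n \<Rightarrow> real ^ 'n ^ 'n \<Rightarrow>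
     (real ^ 'n ^ 'n) \<times> (real ^ 'n ^ 'n::finite) \<Rightarrow> bool" where
  "feasible_assignment lam p f = (\<lambda>(\<alpha>, \<beta>).
     zero_diagonal \<alpha> \<and> zero_diagonal \<beta> \<and>
     (\<forall>i. net_outflow \<alpha> i = imbalance lam p i) \<and>
     (\<forall>i. net_outflow \<beta> i = - imbalance lam p i) \<and>
     (\<forall>i j. 0 \<le> \<alpha> $ i $ j) \<and>
     (\<forall>i j. 0 \<le> \<beta> $ i $ j \<and> \<beta> $ i $ j \<le> f $ i $ j * lam $ i * p $ i $ j))"

definition travel_cost :: "real ^ 'n ^ 'n \<Rightarrow> real ^ 'n ^ 'n::finite \<Rightarrow> real" where
  "travel_cost T A = (\<Sum>i\<in>UNIV. \<Sum>j\<in>UNIV. T $ i $ j * A $ i $ j)"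

definition num_rebalancing_vehicles ::
    "real ^ 'n ^ 'n \<Rightarrow> (real ^ 'n ^ 'n) \<times> (real ^ 'n ^ 'n::finite) \<Rightarrow> real" where
  "num_rebalancing_vehicles T = (\<lambda>(\<alpha>, \<beta>).
     \<Sum>i\<in>UNIV. \<Sum>j\<in>UNIV. T $ i $ j * \<alpha> $ i $ j)"

definition num_drivers ::
    "real ^ 'n ^ 'n \<Rightarrow> (real ^ 'n ^ 'n) \<times> (real ^ 'n ^ 'n::finite) \<Rightarrow> real" where
  "num_drivers T = (\<lambda>(\<alpha>, \<beta>).
     \<Sum>i\<in>UNIV. \<Sum>j\<in>UNIV. T $ i $ j * (\<alpha> $ i $ j + \<beta> $ i $ j))"

end

theory Submission
  imports Defs
begin

text \<open>
  The feasible \<open>\<alpha>\<close> may be unbounded even at bounded cost (\<open>T\<close> may vanish off the diagonal), so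
  compactness does not yield an optimal \<open>\<alpha>\<close>. But \<open>(P\<^sub>\<alpha>)\<close> is a linear program in standard form: its
  constraint and cost maps together send the nonnegative orthant onto a finitely generated cone,
  which is closed, so the set of feasible costs is closed and contains its infimum.
  The feasible \<open>\<beta>\<close> form a compact set. The joint program is a product of the two separate ones
  and its objectives are separable.
\<close>

text \<open>A linear image of a closed convex cone need not be closed, so the orthant's finite
  generation has to be used: its image is the convex cone generated by the finitely many vectors
  \<open>h b\<close>, hence polyhedral, hence closed.\<close>

lemma closed_linear_image_nonneg_orthant:
  fixes h :: "'a::euclidean_space \<Rightarrow> 'b::euclidean_space"
  assumes "linear h"
  shows "closed (h ` {x. \<forall>b\<in>Basis. 0 \<le> x \<bullet> b})" (is "closed (h ` ?K)")
proof -
  have cone: "convex_cone ?K"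
    by (auto simp: convex_cone_iff inner_add_left)
  have "h ` ?K = convex_cone hull (h ` Basis)"
  proof (rule antisym)
    show "h ` ?K \<subseteq> convex_cone hull (h ` Basis)"
    proof clarify
      fix x :: 'a assume x: "\<forall>b\<in>Basis. 0 \<le> x \<bullet> b"
      \<comment> \<open>Partial sums over arbitrary \<open>B\<close> make induction on finite sets
        available; \<open>B = Basis\<close> gives \<open>h x\<close>.\<close>
      have "(\<Sum>b\<in>B. (x \<bullet> b) *\<^sub>R h b) \<in> convex_cone hull (h ` Basis)"
        if "finite B" and "B \<subseteq> Basis" for B
        using that
        by (induction B) (auto simp: x convex_cone_hull_contains_0
            intro!: convex_cone_hull_add convex_cone_hull_mul[OF hull_inc])
      moreover have "h x = (\<Sum>b\<in>Basis. (x \<bullet> b) *\<^sub>R h b)"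
        using arg_cong[OF euclidean_representation[of x], of h] assms
        by (simp add: linear_sum linear_scale)
      ultimately show "h x \<in> convex_cone hull (h ` Basis)" by simp
    qed
    show "convex_cone hull (h ` Basis) \<subseteq> h ` ?K"
      using assms cone
      by (intro hull_minimal convex_cone_linear_image) (auto simp: inner_Basis)
  qed
  then show ?thesis
    by (simp add: polyhedron_convex_cone_hull polyhedron_imp_closed)
qed

text \<open>Only a lower bound on the cost is assumed. The feasible region may be unbounded, so
  compactness is sought neither there nor in the set of costs: a closed nonempty set of reals that
  is bounded below contains its infimum.\<close>

lemma standard_form_lp_attains_min:
  fixes L :: "'a::euclidean_space \<Rightarrow> 'b::euclidean_space" and g :: "'a \<Rightarrow> real"
  assumes "linear L" and "linear g"
    and P: "\<And>x. P x \<longleftrightarrow> L x = d \<and> (\<forall>b\<in>Basis. 0 \<le> x \<bullet> b)"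
    and "P a" and bound: "\<And>x. P x \<Longrightarrow> m \<le> g x"
  shows "\<exists>x. is_arg_min g P x"
proof -
  let ?K = "{x::'a. \<forall>b\<in>Basis. 0 \<le> x \<bullet> b}"
  let ?V = "g ` {x. P x}"
  have bdd: "bdd_below ?V" using bound by (intro bdd_belowI2) auto
  have "linear (\<lambda>x. (L x, g x))"
    using assms(1,2) by (intro linearI) (simp_all add: linear_add linear_scale)
  \<comment> \<open>The attained costs form the slice of the joint image cone over the right-hand
    side \<open>d\<close>.\<close>
  then have "closed (Pair d -` (\<lambda>x. (L x, g x)) ` ?K)"
    by (intro closed_vimage closed_linear_image_nonneg_orthant continuous_intros)
  moreover have "Pair d -` (\<lambda>x. (L x, g x)) ` ?K = ?V"
    by (auto simp: P)
  ultimately have "closed ?V" by simp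
  then have "Inf ?V \<in> ?V"
    using bdd \<open>P a\<close> by (intro closed_contains_Inf) auto
  then obtain x where "P x" and "g x = Inf ?V" by auto
  moreover have "Inf ?V \<le> g y" if "P y" for y
    using bdd that by (intro cInf_lower) auto
  ultimately show ?thesis
    by (auto simp: is_arg_min_linorder)
qed

lemma Basis_matrix_nonneg_iff:
  fixes A :: "real^'m^'n"
  shows "(\<forall>b\<in>Basis. 0 \<le> A \<bullet> b) \<longleftrightarrow> (\<forall>i j. 0 \<le> A $ i $ j)"
  by (auto simp: Basis_vec_def inner_axis)

lemma linear_net_outflow: "linear (\<lambda>A. net_outflow A i)"
  unfolding net_outflow_def
  by (intro linear_compose_sum ballI linearI) (simp_all add: algebra_simps)

lemma linear_travel_cost: "linear (travel_cost T)"
  unfolding travel_cost_def[abs_def]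
  by (rule linearI)
    (simp_all add: algebra_simps sum.distrib sum_distrib_left)

lemma travel_cost_nonneg:
  assumes "\<forall>i j. T $ i $ j \<ge> 0" and "\<forall>i j. A $ i $ j \<ge> 0"
  shows "0 \<le> travel_cost T A"
  unfolding travel_cost_def using assms by (intro sum_nonneg mult_nonneg_nonneg) auto

lemma feasible_alpha_attains_min:
  assumes "\<forall>i j. T $ i $ j \<ge> 0" and "feasible_alpha lam p \<alpha>0"
  shows "\<exists>\<alpha>. is_arg_min (travel_cost T) (feasible_alpha lam p) \<alpha>"
proof (rule standard_form_lp_attains_min)
  \<comment> \<open>The zero diagonal is itself a linear equation, so it is stacked with flow
    balance into one map; the right-hand side is then 0 paired with the imbalances.\<close>
  let ?L = "\<lambda>A::real^'a^'a. (\<chi> i. A $ i $ i, \<chi> i. net_outflow A i)"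
  show "linear ?L"
    by (intro linearI)
      (simp_all add: vec_eq_iff linear_add[OF linear_net_outflow] linear_scale[OF linear_net_outflow])
  show "feasible_alpha lam p \<alpha> \<longleftrightarrow>
      ?L \<alpha> = (0, \<chi> i. imbalance lam p i) \<and> (\<forall>b\<in>Basis. 0 \<le> \<alpha> \<bullet> b)" for \<alpha>
    unfolding Basis_matrix_nonneg_iff
    by (auto simp: feasible_alpha_def zero_diagonal_def vec_eq_iff)
  show "0 \<le> travel_cost T \<alpha>" if "feasible_alpha lam p \<alpha>" for \<alpha>
    using that assms(1) by (intro travel_cost_nonneg) (auto simp: feasible_alpha_def)
qed (fact linear_travel_cost assms(2))+

text \<open>The capacities confine \<beta> to a box, and every constraint is a closed
  condition.\<close>

lemma compact_feasible_beta: "compact {\<beta>. feasible_beta lam p f \<beta>}"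
proof -
  let ?u = "\<chi> i j. f $ i $ j * lam $ i * p $ i $ j"
  have "{\<beta>. feasible_beta lam p f \<beta>} \<subseteq> cbox 0 ?u"
    by (auto simp: feasible_beta_def mem_box Basis_vec_def inner_axis)
  moreover have "closed {\<beta>. feasible_beta lam p f \<beta>}"
    unfolding feasible_beta_def zero_diagonal_def net_outflow_def
    by (intro closed_Collect_conj closed_Collect_all closed_Collect_eq closed_Collect_le
        continuous_intros)
  ultimately show ?thesis
    by (meson bounded_cbox bounded_subset compact_eq_bounded_closed)
qed

lemma feasible_beta_attains_min:
  assumes "feasible_beta lam p f \<beta>0"
  shows "\<exists>\<beta>. is_arg_min (travel_cost T) (feasible_beta lam p f) \<beta>"
proof -
  have "continuous_on {\<beta>. feasible_beta lam p f \<beta>} (travel_cost T)"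
    by (intro linear_continuous_on linear_conv_bounded_linear[THEN iffD1] linear_travel_cost)
  then show ?thesis
    using continuous_attains_inf[OF compact_feasible_beta] assms
    by (fastforce simp: is_arg_min_linorder)
qed

text \<open>No constraint couples \<alpha> with \<beta>, which is why separately computed optima can
  be combined.\<close>

lemma feasible_assignment_iff:
  "feasible_assignment lam p f (\<alpha>, \<beta>) \<longleftrightarrow> feasible_alpha lam p \<alpha> \<and> feasible_beta lam p f \<beta>"
  unfolding feasible_assignment_def feasible_alpha_def feasible_beta_def by auto

lemma num_rebalancing_vehicles_eq: "num_rebalancing_vehicles T (\<alpha>, \<beta>) = travel_cost T \<alpha>"
  by (simp add: num_rebalancing_vehicles_def travel_cost_def)

lemma num_drivers_eq: "num_drivers T (\<alpha>, \<beta>) = travel_cost T \<alpha> + travel_cost T \<beta>"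
  by (simp add: num_drivers_def travel_cost_def distrib_left sum.distrib)

theorem mainTheorem5:
  fixes lam :: "real ^ 'n::finite"
    and p T f :: "real ^ 'n ^ 'n"
  assumes "\<forall>i. lam $ i > 0"
    and "\<forall>i j. p $ i $ j \<ge> 0"
    and "\<forall>i. p $ i $ i = 0"
    and "\<forall>i. (\<Sum>j\<in>UNIV. p $ i $ j) = 1"
    and "\<forall>i j. T $ i $ j \<ge> 0"
    and "\<forall>i j. 0 < f $ i $ j \<and> f $ i $ j \<le> 1"
    and "\<forall>i. imbalance lam p i \<noteq> 0"
    and "\<exists>\<alpha> \<beta>. feasible_assignment lam p f (\<alpha>, \<beta>)"
  shows "(\<exists>\<alpha>. is_arg_min (travel_cost T) (feasible_alpha lam p) \<alpha>) \<and>
    (\<exists>\<beta>. is_arg_min (travel_cost T) (feasible_beta lam p f) \<beta>) \<and>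
    (\<forall>\<alpha>s \<beta>s.
      is_arg_min (travel_cost T) (feasible_alpha lam p) \<alpha>s \<longrightarrow>
      is_arg_min (travel_cost T) (feasible_beta lam p f) \<beta>s \<longrightarrow>
      feasible_assignment lam p f (\<alpha>s, \<beta>s) \<and>
      is_arg_min (num_rebalancing_vehicles T) (feasible_assignment lam p f) (\<alpha>s, \<beta>s) \<and>
      is_arg_min (num_drivers T) (feasible_assignment lam p f) (\<alpha>s, \<beta>s))"
proof (intro conjI allI impI)
  obtain \<alpha>0 \<beta>0 where feas: "feasible_alpha lam p \<alpha>0" "feasible_beta lam p f \<beta>0"
    using assms(8) by (auto simp: feasible_assignment_iff)
  show "\<exists>\<alpha>. is_arg_min (travel_cost T) (feasible_alpha lam p) \<alpha>"
    using assms(5) feas(1) by (rule feasible_alpha_attains_min)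
  show "\<exists>\<beta>. is_arg_min (travel_cost T) (feasible_beta lam p f) \<beta>"
    using feas(2) by (rule feasible_beta_attains_min)
next
  fix \<alpha>s \<beta>s
  assume "is_arg_min (travel_cost T) (feasible_alpha lam p) \<alpha>s"
    and "is_arg_min (travel_cost T) (feasible_beta lam p f) \<beta>s"
  \<comment> \<open>The vehicle count depends on \<alpha> alone. The driver count is a sum of two
    costs, each minimized separately, so adding the two inequalities suffices.\<close>
  then show "feasible_assignment lam p f (\<alpha>s, \<beta>s)"
    and "is_arg_min (num_rebalancing_vehicles T) (feasible_assignment lam p f) (\<alpha>s, \<beta>s)"
    and "is_arg_min (num_drivers T) (feasible_assignment lam p f) (\<alpha>s, \<beta>s)"
    by (auto simp: is_arg_min_linorder feasible_assignment_iff num_rebalancing_vehicles_eq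
        num_drivers_eq intro: add_mono)
qed

end
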